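(* Let $G$ be a finite group and $g\in G'$. If $H$ and $K$ are two subgroups of $G$, then $$\Pr\nolimits_g(H,K)=\frac{1}{|H||K|}\sum_{\substack{x\in H\\ g^{-1}x\in\operatorname{Cl}_K(x)}}|C_K(x)|=\frac{1}{|H|}\sum_{\substack{x\in H\\ g^{-1}x\in\operatorname{Cl}_K(x)}}\frac{1}{|\operatorname{Cl}_K(x)|}.$$
   Context: $G'$ is the commutator subgroup; $[x,y]=xyx^{-1}y^{-1}$; $\Pr_g(H,K)=|\{(x,y)\in H\times K:[x,y]=g\}|/(|H||K|)$. For $x\in G$, $C_K(x)=\{y\in K:xy=yx\}$ and $\operatorname{Cl}_K(x)=\{yxy^{-1}:y\in K\}$ (the $K$-conjugacy class of $x$). *)

theory Defs
  imports Complex_Main "HOL-Algebra.Generated_Groups"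
begin

definition group_commutator :: "('a, 'b) monoid_scheme \<Rightarrow> 'a \<Rightarrow> 'a \<Rightarrow> 'a"
  where "group_commutator G x y = x \<otimes>\<^bsub>G\<^esub> y \<otimes>\<^bsub>G\<^esub> inv\<^bsub>G\<^esub> x \<otimes>\<^bsub>G\<^esub> inv\<^bsub>G\<^esub> y"

definition commutator_prob ::
    "('a, 'b) monoid_scheme \<Rightarrow> 'a \<Rightarrow> 'a set \<Rightarrow> 'a set \<Rightarrow> real"
  where "commutator_prob G g H K =
    real (card {(x, y) \<in> H \<times> K. group_commutator G x y = g}) / (real (card H) * real (card K))"

definition centralizer_in :: "('a, 'b) monoid_scheme \<Rightarrow> 'a set \<Rightarrow> 'a \<Rightarrow> 'a set"
  where "centralizer_in G K x = {y \<in> K. x \<otimes>\<^bsub>G\<^esub> y = y \<otimes>\<^bsub>G\<^esub> x}"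

definition conj_class_in :: "('a, 'b) monoid_scheme \<Rightarrow> 'a set \<Rightarrow> 'a \<Rightarrow> 'a set"
  where "conj_class_in G K x = {y \<otimes>\<^bsub>G\<^esub> x \<otimes>\<^bsub>G\<^esub> inv\<^bsub>G\<^esub> y | y. y \<in> K}"

end

theory Submission
  imports Defs
begin

text \<open>
  The commutator identity \<open>[x, y] = g\<close> is the same as \<open>y x y\<inverse> = g\<inverse> x\<close>, so the pairs counted by the
  probability split according to \<open>x\<close>, and for given \<open>x\<close> one counts the \<open>y \<in> K\<close> that conjugate \<open>x\<close>
  to \<open>g\<inverse> x\<close>. This set is empty unless \<open>g\<inverse> x\<close> is a \<open>K\<close>-conjugate of \<open>x\<close>, in which case it is a left
  coset of the centralizer of \<open>x\<close> in \<open>K\<close> (lemma \<open>card_conjugators\<close>). This gives the first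
  formula; the second follows by the orbit-stabilizer relation (lemma
  \<open>card_centralizer_times_conj_class\<close>), which comes from the same count applied to every element
  of the class.
\<close>

lemma (in group) commutator_eq_iff_conjugate:
  assumes "x \<in> carrier G" "y \<in> carrier G" "g \<in> carrier G"
  shows "group_commutator G x y = g \<longleftrightarrow> y \<otimes> x \<otimes> inv y = inv g \<otimes> x"
proof -
  have comm: "group_commutator G x y = x \<otimes> inv (y \<otimes> x \<otimes> inv y)"
    using assms by (simp add: group_commutator_def inv_mult_group m_assoc)
  have "x \<otimes> inv z = g \<longleftrightarrow> z = inv g \<otimes> x" if "z \<in> carrier G" for z
    using inv_solve_right'[of g x z] inv_solve_left[of z g x] assms(1,3) that by simp
  then show ?thesis
    using comm assms by simp
qed

lemma (in group) conjugates_eq_iff_commute: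
  assumes "x \<in> carrier G" "k \<in> carrier G" "c \<in> carrier G"
  shows "k \<otimes> c \<otimes> x \<otimes> inv (k \<otimes> c) = k \<otimes> x \<otimes> inv k \<longleftrightarrow> x \<otimes> c = c \<otimes> x"
proof -
  have "k \<otimes> c \<otimes> x \<otimes> inv (k \<otimes> c) = k \<otimes> (c \<otimes> x \<otimes> inv c) \<otimes> inv k"
    using assms by (simp add: inv_mult_group m_assoc)
  then have "k \<otimes> c \<otimes> x \<otimes> inv (k \<otimes> c) = k \<otimes> x \<otimes> inv k \<longleftrightarrow> c \<otimes> x \<otimes> inv c = x"
    using assms by simp
  also have "\<dots> \<longleftrightarrow> x \<otimes> c = c \<otimes> x"
    using inv_solve_right'[of x "c \<otimes> x" c] assms by auto
  finally show ?thesis .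
qed

lemma (in group) card_conjugators:
  assumes K: "subgroup K G" and x: "x \<in> carrier G" and z: "z \<in> conj_class_in G K x"
  shows "card {y \<in> K. y \<otimes> x \<otimes> inv y = z} = card (centralizer_in G K x)"
proof -
  interpret K: subgroup K G by (rule K)
  obtain k where k: "k \<in> K" and zk: "z = k \<otimes> x \<otimes> inv k"
    using z by (auto simp: conj_class_in_def)
  have kc: "k \<in> carrier G"
    using k by simp
  have "bij_betw (\<lambda>c. k \<otimes> c) (centralizer_in G K x) {y \<in> K. y \<otimes> x \<otimes> inv y = z}"
  proof (rule bij_betw_byWitness[where f' = "\<lambda>y. inv k \<otimes> y"])
    show "\<forall>c\<in>centralizer_in G K x. inv k \<otimes> (k \<otimes> c) = c"
      using kc by (auto simp: centralizer_in_def m_assoc[symmetric])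
    show "\<forall>y\<in>{y \<in> K. y \<otimes> x \<otimes> inv y = z}. k \<otimes> (inv k \<otimes> y) = y"
      using kc by (auto simp: m_assoc[symmetric])
    show "(\<lambda>c. k \<otimes> c) ` centralizer_in G K x \<subseteq> {y \<in> K. y \<otimes> x \<otimes> inv y = z}"
      using k kc x conjugates_eq_iff_commute by (auto simp: centralizer_in_def zk)
    show "(\<lambda>y. inv k \<otimes> y) ` {y \<in> K. y \<otimes> x \<otimes> inv y = z} \<subseteq> centralizer_in G K x"
    proof clarify
      fix y assume y: "y \<in> K" "z = y \<otimes> x \<otimes> inv y"
      have "k \<otimes> (inv k \<otimes> y) = y"
        using y kc by (simp add: m_assoc[symmetric])
      then have "x \<otimes> (inv k \<otimes> y) = inv k \<otimes> y \<otimes> x"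
        using conjugates_eq_iff_commute[OF x kc, of "inv k \<otimes> y"] y k kc zk by simp
      then show "inv k \<otimes> y \<in> centralizer_in G K x"
        using y k by (simp add: centralizer_in_def)
    qed
  qed
  then show ?thesis
    by (simp add: bij_betw_same_card)
qed

lemma (in group) card_centralizer_times_conj_class:
  assumes K: "subgroup K G" and fin: "finite K" and x: "x \<in> carrier G"
  shows "card (centralizer_in G K x) * card (conj_class_in G K x) = card K"
proof -
  have class_image: "conj_class_in G K x = (\<lambda>y. y \<otimes> x \<otimes> inv y) ` K"
    by (auto simp: conj_class_in_def)
  have "card K = (\<Sum>z\<in>conj_class_in G K x. card {y \<in> K. y \<otimes> x \<otimes> inv y = z})"
    using sum.group[OF fin, of "conj_class_in G K x" "\<lambda>y. y \<otimes> x \<otimes> inv y" "\<lambda>_. 1::nat"] fin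
    by (simp add: class_image)
  also have "\<dots> = (\<Sum>z\<in>conj_class_in G K x. card (centralizer_in G K x))"
    by (intro sum.cong refl card_conjugators[OF K x])
  finally show ?thesis
    by (simp add: mult.commute)
qed

lemma (in group) card_commutator_pairs:
  assumes H: "H \<subseteq> carrier G" "finite H" and K: "subgroup K G" "finite K" and g: "g \<in> carrier G"
  shows "card {(x, y) \<in> H \<times> K. group_commutator G x y = g} =
    (\<Sum>x | x \<in> H \<and> inv g \<otimes> x \<in> conj_class_in G K x. card (centralizer_in G K x))"
proof -
  let ?X = "{x. x \<in> H \<and> inv g \<otimes> x \<in> conj_class_in G K x}"
  let ?F = "\<lambda>x. {y \<in> K. y \<otimes> x \<otimes> inv y = inv g \<otimes> x}"
  have iff: "group_commutator G x y = g \<longleftrightarrow> y \<otimes> x \<otimes> inv y = inv g \<otimes> x" if "x \<in> H" "y \<in> K" for x y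
    using that H(1) subgroup.subset[OF K(1)] g by (intro commutator_eq_iff_conjugate) auto
  have pairs: "{(x, y) \<in> H \<times> K. group_commutator G x y = g} = (SIGMA x:?X. ?F x)"
  proof (intro equalityI subsetI)
    fix p assume "p \<in> {(x, y) \<in> H \<times> K. group_commutator G x y = g}"
    then obtain x y where p: "p = (x, y)" "x \<in> H" "y \<in> K" "y \<otimes> x \<otimes> inv y = inv g \<otimes> x"
      using iff by auto
    then have "inv g \<otimes> x \<in> conj_class_in G K x"
      by (auto simp: conj_class_in_def intro!: exI[of _ y])
    then show "p \<in> (SIGMA x:?X. ?F x)"
      using p by simp
  qed (use iff in auto)
  have "card (SIGMA x:?X. ?F x) = (\<Sum>x\<in>?X. card (?F x))"
    using H(2) K(2) by simp
  also have "\<dots> = (\<Sum>x\<in>?X. card (centralizer_in G K x))"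
  proof (rule sum.cong[OF refl])
    fix x assume "x \<in> ?X"
    then have "x \<in> carrier G" "inv g \<otimes> x \<in> conj_class_in G K x"
      using H(1) by blast+
    then show "card (?F x) = card (centralizer_in G K x)"
      by (rule card_conjugators[OF K(1)])
  qed
  finally show ?thesis
    by (simp only: pairs)
qed

theorem theorem5p1p3:
  fixes G (structure) and g :: 'a and H K :: "'a set"
  assumes "group G" and "finite (carrier G)"
    and "g \<in> derived G (carrier G)"
    and "subgroup H G" and "subgroup K G"
  shows "commutator_prob G g H K =
      1 / (real (card H) * real (card K)) *
        (\<Sum>x | x \<in> H \<and> inv g \<otimes> x \<in> conj_class_in G K x. real (card (centralizer_in G K x)))
    \<and> 1 / (real (card H) * real (card K)) *
        (\<Sum>x | x \<in> H \<and> inv g \<otimes> x \<in> conj_class_in G K x. real (card (centralizer_in G K x))) =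
      1 / real (card H) *
        (\<Sum>x | x \<in> H \<and> inv g \<otimes> x \<in> conj_class_in G K x. 1 / real (card (conj_class_in G K x)))"
proof -
  interpret group G by (rule assms(1))
  have H: "H \<subseteq> carrier G" "finite H" and K: "finite K"
    using assms(2,4,5) by (auto dest: subgroup.subset intro: finite_subset)
  have g: "g \<in> carrier G"
    using assms(3) derived_in_carrier[of "carrier G"] by auto
  have Kpos: "card K > 0"
    using K subgroup.one_closed[OF assms(5)] by (auto simp: card_gt_0_iff)
  have centralizer: "real (card (centralizer_in G K x)) / real (card K) =
      1 / real (card (conj_class_in G K x))" if "x \<in> H" for x
  proof -
    have "real (card (centralizer_in G K x)) * real (card (conj_class_in G K x)) = real (card K)"
      using card_centralizer_times_conj_class[OF assms(5) K, of x] that H(1)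
      by (simp flip: of_nat_mult add: subsetD)
    moreover from this have "card (conj_class_in G K x) \<noteq> 0"
      using Kpos by (intro notI) simp
    ultimately show ?thesis
      using Kpos by (simp add: frac_eq_eq)
  qed
  let ?X = "{x. x \<in> H \<and> inv g \<otimes> x \<in> conj_class_in G K x}"
  have "1 / (real (card H) * real (card K)) * (\<Sum>x\<in>?X. real (card (centralizer_in G K x))) =
      1 / real (card H) * (\<Sum>x\<in>?X. real (card (centralizer_in G K x)) / real (card K))"
    by (simp add: sum_divide_distrib[symmetric])
  also have "\<dots> = 1 / real (card H) * (\<Sum>x\<in>?X. 1 / real (card (conj_class_in G K x)))"
    using centralizer by simp
  finally show ?thesis
    using card_commutator_pairs[OF H assms(5) K g] by (simp add: commutator_prob_def)
qed

end
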